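(* Consider the full-order solution and the WST-LSPG solution over windows $0,\dots,N_w-1$, as defined in the context. Assume: (A1) there is $\kappa>0$ with $\|\boldsymbol f(\boldsymbol w,t)-\boldsymbol f(\boldsymbol y,t)\|_2\le\kappa\|\boldsymbol w-\boldsymbol y\|_2$ for all $\boldsymbol w,\boldsymbol y\in\mathbb R^{N_s}$, $t\in[0,T]$; (A2) $\sigma_{\min}(\boldsymbol A^k)-\sigma_{\max}(\boldsymbol B^k)\,\Delta t\,\kappa>0$ for every window $k\in\{0,\dots,N_w-1\}$. Set $a^k=\sigma_{\min}(\boldsymbol A^k)-\sigma_{\max}(\boldsymbol B^k)\Delta t\,\kappa$ and $b^k=\sigma_{\max}(\boldsymbol A_0^k)+\Delta t\,\kappa\,\sigma_{\max}(\boldsymbol B_0^k)$. For each window $i$ let $\mathbb P\boldsymbol u^i=\arg\min_{\boldsymbol w\in\mathcal S^i}\|\boldsymbol u^i-\boldsymbol w\|_2$ be the $\ell^2$-orthogonal projection of the full-order solution onto the trial space of window $i$, and let $\mathbb P\boldsymbol u_0^i$ be the $\ell^2$-orthogonal projection of the full-order starting state $\boldsymbol u_0^i$ onto the (affine) trial subspace $\mathcal T^i\subseteq\mathbb R^{N_s}$ for the starting state, which contains $\tilde{\boldsymbol u}_0^i$. Then for every $k\in\{0,\dots,N_w-1\}$ the error $\boldsymbol e^k=\tilde{\boldsymbol u}^k-\boldsymbol u^k$ of the WST-LSPG solution over the $k$-th window satisfies $$\|\boldsymbol e^k\|_2\le\sum_{i=0}^{k}\left(\frac{\prod_{j=0}^{k-i-1}2\,b^{k-j}}{\prod_{j=0}^{k-i}a^{k-j}}\right)\big\|\overline{\boldsymbol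 r}^i(\mathbb P\boldsymbol u^i;\mathbb P\boldsymbol u_0^i)\big\|_2,$$ where products include both limits and an empty product equals $1$.
   Context: All superscripts $k,i,k-j$ on $a,b,\boldsymbol e,\boldsymbol u,\tilde{\boldsymbol u},\overline{\boldsymbol r}$ and the matrices are window indices, not powers. $\sigma_{\min},\sigma_{\max}$ denote minimum and maximum singular values; $\|\cdot\|_2$ is the Euclidean norm. A parameter value is fixed and suppressed. Full-order model: an ODE $\dot{\boldsymbol u}=\boldsymbol f(\boldsymbol u,t)$ with $\boldsymbol f:\mathbb R^{N_s}\times[0,T]\to\mathbb R^{N_s}$ and initial state $\boldsymbol u^{\mathrm{init}}\in\mathbb R^{N_s}$ is discretized at times $t^0<t^1<\dots<t^{N_t}$ with constant step $\Delta t>0$ by a linear multistep method with stencil width $s_n$ at step $n$: coefficients $\alpha_j^n,\beta_j^n\in\mathbb R$, $0\le j\le s_n$, with $\alpha_0^n\ne0$ and $\sum_{j=0}^{s_n}\alpha_j^n=0$, and residual $$\boldsymbol r^n(\boldsymbol w^n;\boldsymbol w^{n-1},\dots,\boldsymbol w^{n-s_n})=\sum_{j=0}^{s_n}\alpha_j^n\boldsymbol w^{n-j}-\Delta t\sum_{j=0}^{s_n}\beta_j^n\boldsymbol f(\boldsymbol w^{n-j},t^{n-j}).$$ Windows: the steps $1,\dots,N_t$ are partitioned into $N_w$ consecutive windows; window $k\in\{0,\dots,N_w-1\}$ contains $N_t^k$ steps, namely $\theta(k),\dots,\theta(k)+N_t^k-1$, with $\theta(k)=1+\sum_{j=0}^{k-1}N_t^j$.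 The stencil width at the first step of each window is one ($s_{\theta(k)}=1$), and no stencil inside a window reaches back before the state at step $\theta(k)-1$ (i.e. $s_{\theta(k)+\ell-1}\le\ell$ for $1\le\ell\le N_t^k$). Windowed residual: for $\boldsymbol w=[(\boldsymbol w^1)^T\cdots(\boldsymbol w^{N_t^k})^T]^T\in\mathbb R^{N_sN_t^k}$ and starting state $\boldsymbol w_0\in\mathbb R^{N_s}$, $\overline{\boldsymbol r}^k(\boldsymbol w;\boldsymbol w_0)\in\mathbb R^{N_sN_t^k}$ stacks the residuals of all steps of window $k$ (with $\boldsymbol w^\ell$ the state at step $\theta(k)+\ell-1$ and $\boldsymbol w_0$ the state at step $\theta(k)-1$). Equivalently $$\overline{\boldsymbol r}^k(\boldsymbol w;\boldsymbol w_0)=\boldsymbol A^k\boldsymbol w-\Delta t\,\boldsymbol B^k\,\overline{\boldsymbol f}^k(\boldsymbol w)+\boldsymbol A_0^k\boldsymbol w_0-\Delta t\,\boldsymbol B_0^k\boldsymbol f(\boldsymbol w_0,t^{\theta(k)-1}),$$ where $\overline{\boldsymbol f}^k(\boldsymbol w)$ stacks $\boldsymbol f(\boldsymbol w^\ell,t^{\theta(k)+\ell-1})$, $\ell=1,\dots,N_t^k$; $\boldsymbol A^k\in\mathbb R^{N_sN_t^k\times N_sN_t^k}$ has $N_s\times N_s$ block $(\ell,\ell-j)$ equal to $\alpha_j^{\theta(k)+\ell-1}\boldsymbol I$ for $0\le j\le s_{\theta(k)+\ell-1}$, $\ell-j\ge1$, other blocks zero; $\boldsymbol A_0^k\in\mathbb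 R^{N_sN_t^k\times N_s}$ has $\ell$-th block $\alpha_\ell^{\theta(k)+\ell-1}\boldsymbol I$ if $s_{\theta(k)+\ell-1}=\ell$ and zero otherwise; $\boldsymbol B^k,\boldsymbol B_0^k$ are defined identically with $\beta$ in place of $\alpha$. Full-order solution: $\boldsymbol u^k\in\mathbb R^{N_sN_t^k}$ with starting state $\boldsymbol u_0^k$ satisfies $\overline{\boldsymbol r}^k(\boldsymbol u^k;\boldsymbol u_0^k)=\boldsymbol 0$, where $\boldsymbol u_0^0=\boldsymbol u^{\mathrm{init}}$ and, for $k\ge1$, $\boldsymbol u_0^k$ is the last $N_s$-block of $\boldsymbol u^{k-1}$. WST-LSPG solution (windowed space--time least-squares Petrov--Galerkin, no hyper-reduction): computed sequentially for $k=0,\dots,N_w-1$. The starting state is $\tilde{\boldsymbol u}_0^0=\boldsymbol u^{\mathrm{init}}$ and, for $k\ge1$, $\tilde{\boldsymbol u}_0^k$ is the last $N_s$-block of $\tilde{\boldsymbol u}^{k-1}$. Given a basis matrix $\boldsymbol\Pi^k\in\mathbb R^{N_sN_t^k\times n^k}$, the affine trial subspace is $\mathcal S^k=\{\boldsymbol u_{\mathrm{ref}}^k+\boldsymbol\Pi^k\boldsymbol z:\boldsymbol z\in\mathbb R^{n^k}\}$, where $\boldsymbol u_{\mathrm{ref}}^k$ stacks $N_t^k$ copies of $\tilde{\boldsymbol u}_0^k$, and $\tilde{\boldsymbol u}^k\in\mathcal S^k$ is a minimizer of $\boldsymbol w\mapsto\|\overline{\boldsymbol r}^k(\boldsymbol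 w;\tilde{\boldsymbol u}_0^k)\|_2^2$ over $\mathcal S^k$. Trial subspace for starting states: $\mathcal T^k\subseteq\mathbb R^{N_s}$ is an affine subspace in which the reduced model's starting state lives; the only property used is that it is an affine subspace with $\tilde{\boldsymbol u}_0^k\in\mathcal T^k$. *)

theory Defs
  imports Complex_Main "Jordan_Normal_Form.Char_Poly"
begin

text \<open>
  The lengths of the windows vary, so vectors and matrices are those of
  \<^theory>\<open>Jordan_Normal_Form.Matrix\<close>, whose dimensions are terms. The synonyms avoid the clash with
  the type constructor \<open>vec\<close> of HOL-Analysis in theories that import both.
\<close>

type_synonym rvec = "real vec"
type_synonym rmat = "real mat"

definition vnorm :: "rvec \<Rightarrow> real" where
  "vnorm v = sqrt (v \<bullet> v)"

text \<open>
  An \<open>m \<times> n\<close> matrix has \<open>min m n\<close> singular values, so the smaller of the two Gram matrices is used;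
  the larger one may have additional zero eigenvalues.
\<close>

definition singular_values :: "rmat \<Rightarrow> real set" where
  "singular_values M =
     {sqrt e | e. eigenvalue (if dim_col M \<le> dim_row M then transpose_mat M * M
                              else M * transpose_mat M) e}"

definition sigma_min :: "rmat \<Rightarrow> real" where
  "sigma_min M = Min (singular_values M)"

definition sigma_max :: "rmat \<Rightarrow> real" where
  "sigma_max M = Max (singular_values M)"

text \<open>The condition of \<open>affine\<close> in HOL-Analysis, which is only available for type-class vectors.\<close>

definition affine_subspace :: "nat \<Rightarrow> rvec set \<Rightarrow> bool" where
  "affine_subspace d S \<longleftrightarrow>
     S \<noteq> {} \<and> S \<subseteq> carrier_vec d \<and>
     (\<forall>x\<in>S. \<forall>y\<in>S. \<forall>u v. u + v = 1 \<longrightarrow> u \<cdot>\<^sub>v x + v \<cdot>\<^sub>v y \<in> S)"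

text \<open>Blocks are numbered from 1, entries within a block from 0.\<close>

definition vec_block :: "nat \<Rightarrow> rvec \<Rightarrow> nat \<Rightarrow> rvec" where
  "vec_block Ns w l = vec Ns (\<lambda>i. w $ ((l - 1) * Ns + i))"

definition stack :: "nat \<Rightarrow> nat \<Rightarrow> (nat \<Rightarrow> rvec) \<Rightarrow> rvec" where
  "stack Ns m g = vec (Ns * m) (\<lambda>p. g (p div Ns + 1) $ (p mod Ns))"

text \<open>
  \<open>Nt k\<close> is the number of steps of window \<open>k\<close>, \<open>s n\<close> the stencil width at step \<open>n\<close>, and
  \<open>\<alpha> n j\<close>, \<open>\<beta> n j\<close> are the multistep coefficients at step \<open>n\<close>.
\<close>

definition theta :: "(nat \<Rightarrow> nat) \<Rightarrow> nat \<Rightarrow> nat" where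
  "theta Nt k = 1 + (\<Sum>j<k. Nt j)"

text \<open>In the residual of step \<open>n\<close>, \<open>W m\<close> is the state at step \<open>m\<close>.\<close>

definition lmm_residual ::
  "nat \<Rightarrow> (rvec \<Rightarrow> real \<Rightarrow> rvec) \<Rightarrow> real \<Rightarrow> (nat \<Rightarrow> real) \<Rightarrow> (nat \<Rightarrow> nat) \<Rightarrow>
   (nat \<Rightarrow> nat \<Rightarrow> real) \<Rightarrow> (nat \<Rightarrow> nat \<Rightarrow> real) \<Rightarrow> nat \<Rightarrow> (nat \<Rightarrow> rvec) \<Rightarrow> rvec" where
  "lmm_residual Ns f dt t s \<alpha> \<beta> n W =
     vec Ns (\<lambda>i. (\<Sum>j\<le>s n. \<alpha> n j * W (n - j) $ i)
                 - dt * (\<Sum>j\<le>s n. \<beta> n j * f (W (n - j)) (t (n - j)) $ i))"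

definition window_state :: "nat \<Rightarrow> (nat \<Rightarrow> nat) \<Rightarrow> nat \<Rightarrow> rvec \<Rightarrow> rvec \<Rightarrow> nat \<Rightarrow> rvec" where
  "window_state Ns Nt k w w0 m =
     (if m = theta Nt k - 1 then w0 else vec_block Ns w (m + 1 - theta Nt k))"

definition window_residual ::
  "nat \<Rightarrow> (rvec \<Rightarrow> real \<Rightarrow> rvec) \<Rightarrow> real \<Rightarrow> (nat \<Rightarrow> real) \<Rightarrow> (nat \<Rightarrow> nat) \<Rightarrow> (nat \<Rightarrow> nat) \<Rightarrow>
   (nat \<Rightarrow> nat \<Rightarrow> real) \<Rightarrow> (nat \<Rightarrow> nat \<Rightarrow> real) \<Rightarrow> nat \<Rightarrow> rvec \<Rightarrow> rvec \<Rightarrow> rvec" where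
  "window_residual Ns f dt t Nt s \<alpha> \<beta> k w w0 =
     stack Ns (Nt k) (\<lambda>l. lmm_residual Ns f dt t s \<alpha> \<beta> (theta Nt k + l - 1) (window_state Ns Nt k w w0))"

text \<open>
  With \<open>c = \<alpha>\<close> the next two are the matrices \<open>A\<^sup>k\<close> and \<open>A\<^sub>0\<^sup>k\<close>, with \<open>c = \<beta>\<close> they are
  \<open>B\<^sup>k\<close> and \<open>B\<^sub>0\<^sup>k\<close>. Entry \<open>(p, q)\<close> lies in block row \<open>l\<close> and block column \<open>l'\<close>.
\<close>

definition lmm_mat ::
  "nat \<Rightarrow> (nat \<Rightarrow> nat) \<Rightarrow> (nat \<Rightarrow> nat) \<Rightarrow> (nat \<Rightarrow> nat \<Rightarrow> real) \<Rightarrow> nat \<Rightarrow> rmat" where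
  "lmm_mat Ns Nt s c k =
     mat (Ns * Nt k) (Ns * Nt k) (\<lambda>(p, q).
       let l = p div Ns + 1; l' = q div Ns + 1; n = theta Nt k + l - 1 in
       if p mod Ns = q mod Ns \<and> l' \<le> l \<and> l - l' \<le> s n then c n (l - l') else 0)"

definition lmm_mat0 ::
  "nat \<Rightarrow> (nat \<Rightarrow> nat) \<Rightarrow> (nat \<Rightarrow> nat) \<Rightarrow> (nat \<Rightarrow> nat \<Rightarrow> real) \<Rightarrow> nat \<Rightarrow> rmat" where
  "lmm_mat0 Ns Nt s c k =
     mat (Ns * Nt k) Ns (\<lambda>(p, q).
       let l = p div Ns + 1; n = theta Nt k + l - 1 in
       if p mod Ns = q \<and> s n = l then c n l else 0)"

definition start_state :: "nat \<Rightarrow> (nat \<Rightarrow> nat) \<Rightarrow> rvec \<Rightarrow> (nat \<Rightarrow> rvec) \<Rightarrow> nat \<Rightarrow> rvec" where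
  "start_state Ns Nt uinit u k =
     (if k = 0 then uinit else vec_block Ns (u (k - 1)) (Nt (k - 1)))"

definition trial_space :: "nat \<Rightarrow> nat \<Rightarrow> rvec \<Rightarrow> rmat \<Rightarrow> rvec set" where
  "trial_space Ns m v0 V =
     {stack Ns m (\<lambda>_. v0) + V *\<^sub>v z | z. z \<in> carrier_vec (dim_col V)}"

lemma window_residual_matrix_form:
  assumes Ns: "Ns \<ge> 1"
    and w: "w \<in> carrier_vec (Ns * Nt k)" and w0: "w0 \<in> carrier_vec Ns"
    and f0: "f w0 (t (theta Nt k - 1)) \<in> carrier_vec Ns"
    and st: "\<And>l. 1 \<le> l \<Longrightarrow> l \<le> Nt k \<Longrightarrow> s (theta Nt k + l - 1) \<le> l"
  shows "window_residual Ns f dt t Nt s \<alpha> \<beta> k w w0 =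
     lmm_mat Ns Nt s \<alpha> k *\<^sub>v w
     - dt \<cdot>\<^sub>v (lmm_mat Ns Nt s \<beta> k *\<^sub>v
               stack Ns (Nt k) (\<lambda>l. f (vec_block Ns w l) (t (theta Nt k + l - 1))))
     + lmm_mat0 Ns Nt s \<alpha> k *\<^sub>v w0
     - dt \<cdot>\<^sub>v (lmm_mat0 Ns Nt s \<beta> k *\<^sub>v f w0 (t (theta Nt k - 1)))"
proof -
  have key: "(\<Sum>j\<le>s n. c n j * g (n - j) $ (p mod Ns)) =
       (lmm_mat Ns Nt s c k *\<^sub>v stack Ns (Nt k) (\<lambda>l. g (theta Nt k + l - 1))) $ p
       + (lmm_mat0 Ns Nt s c k *\<^sub>v g (theta Nt k - 1)) $ p"
    if p: "p < Ns * Nt k" and n: "n = theta Nt k + (p div Ns + 1) - 1"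
      and g0: "g (theta Nt k - 1) \<in> carrier_vec Ns"
    for c :: "nat \<Rightarrow> nat \<Rightarrow> real" and g p n
  proof -
    define l where "l = p div Ns + 1"
    define i where "i = p mod Ns"
    have i: "i < Ns" using Ns by (simp add: i_def)
    have l: "1 \<le> l" "l \<le> Nt k"
      using p Ns by (auto simp: l_def less_mult_imp_div_less mult.commute Suc_le_eq)
    have sn: "s n \<le> l" using st[OF l] by (simp add: n l_def)
    have th: "theta Nt k \<ge> 1" by (simp add: theta_def)
    have nl: "n = theta Nt k + l - 1" by (simp add: n l_def)
    have "(lmm_mat Ns Nt s c k *\<^sub>v stack Ns (Nt k) (\<lambda>l. g (theta Nt k + l - 1))) $ p
      = (\<Sum>q<Ns * Nt k. (if i = q mod Ns \<and> q div Ns + 1 \<le> l \<and> l - (q div Ns + 1) \<le> s n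
            then c n (l - (q div Ns + 1)) else 0) * g (theta Nt k + (q div Ns + 1) - 1) $ (q mod Ns))"
      using p
      by (auto simp: lmm_mat_def stack_def scalar_prod_def l_def i_def n Let_def
               lessThan_atLeast0 intro!: sum.cong)
    also have "\<dots> = (\<Sum>q | q < Ns * Nt k \<and> i = q mod Ns \<and> q div Ns + 1 \<le> l \<and> l - (q div Ns + 1) \<le> s n.
            c n (l - (q div Ns + 1)) * g (theta Nt k + (q div Ns + 1) - 1) $ i)"
      by (rule sum.mono_neutral_cong_right) auto
    also have "\<dots> = (\<Sum>j | j \<le> s n \<and> j < l. c n j * g (n - j) $ i)"
    proof (rule sum.reindex_bij_witness[of _ "\<lambda>j. (l - j - 1) * Ns + i" "\<lambda>q. l - (q div Ns + 1)"])
      fix q assume q: "q \<in> {q. q < Ns * Nt k \<and> i = q mod Ns \<and> q div Ns + 1 \<le> l \<and> l - (q div Ns + 1) \<le> s n}"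
      then have "l - (l - (q div Ns + 1)) - 1 = q div Ns" by auto
      then show "(l - (l - (q div Ns + 1)) - 1) * Ns + i = q" using q by (simp add: div_mult_mod_eq)
      show "l - (q div Ns + 1) \<in> {j. j \<le> s n \<and> j < l}" using q by auto
      have "n - (l - (q div Ns + 1)) = theta Nt k + (q div Ns + 1) - 1" using q nl th by auto
      then show "c n (l - (q div Ns + 1)) * g (n - (l - (q div Ns + 1))) $ i =
         c n (l - (q div Ns + 1)) * g (theta Nt k + (q div Ns + 1) - 1) $ i" by simp
    next
      fix j assume j: "j \<in> {j. j \<le> s n \<and> j < l}"
      have d: "((l - j - 1) * Ns + i) div Ns = l - j - 1" using i by simp
      show "l - (((l - j - 1) * Ns + i) div Ns + 1) = j" using j unfolding d by auto
      have "(l - j - 1) * Ns + i < (l - j - 1) * Ns + Ns" using i by simp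
      also have "\<dots> = (l - j) * Ns" using j by (cases "l - j") auto
      also have "\<dots> \<le> Nt k * Ns" using l by (intro mult_right_mono) auto
      finally show "(l - j - 1) * Ns + i \<in> {q. q < Ns * Nt k \<and> i = q mod Ns \<and> q div Ns + 1 \<le> l \<and> l - (q div Ns + 1) \<le> s n}"
        using j i by (auto simp: d mult.commute)
    qed
    finally have 1: "(lmm_mat Ns Nt s c k *\<^sub>v stack Ns (Nt k) (\<lambda>l. g (theta Nt k + l - 1))) $ p
        = (\<Sum>j | j \<le> s n \<and> j < l. c n j * g (n - j) $ i)" .
    have "(lmm_mat0 Ns Nt s c k *\<^sub>v g (theta Nt k - 1)) $ p
       = (\<Sum>q<Ns. (if i = q \<and> s n = l then c n l else 0) * g (theta Nt k - 1) $ q)"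
      using p g0
      by (auto simp: lmm_mat0_def scalar_prod_def l_def i_def n Let_def
               lessThan_atLeast0 intro!: sum.cong)
    also have "\<dots> = (\<Sum>q<Ns. if q = i then (if s n = l then c n l * g (theta Nt k - 1) $ i else 0) else 0)"
      by (rule sum.cong) auto
    also have "\<dots> = (if s n = l then c n l * g (theta Nt k - 1) $ i else 0)"
      using i by simp
    also have "\<dots> = (\<Sum>j | j \<le> s n \<and> \<not> j < l. c n j * g (n - j) $ i)"
    proof (cases "s n = l")
      case True
      then have "{j. j \<le> s n \<and> \<not> j < l} = {l}" by auto
      moreover have "n - l = theta Nt k - 1" using nl th by simp
      ultimately show ?thesis using True by simp
    next
      case False
      then have "{j. j \<le> s n \<and> \<not> j < l} = {}" using sn by auto
      with False show ?thesis by (simp only: if_False sum.empty)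
    qed
    finally have 2: "(lmm_mat0 Ns Nt s c k *\<^sub>v g (theta Nt k - 1)) $ p
       = (\<Sum>j | j \<le> s n \<and> \<not> j < l. c n j * g (n - j) $ i)" .
    have "(\<Sum>j\<le>s n. c n j * g (n - j) $ i) =
        (\<Sum>j | j \<le> s n \<and> j < l. c n j * g (n - j) $ i)
        + (\<Sum>j | j \<le> s n \<and> \<not> j < l. c n j * g (n - j) $ i)"
      by (subst sum.union_disjoint[symmetric]) (auto intro!: sum.cong)
    then show ?thesis unfolding 1 2 by (simp add: i_def)
  qed
  let ?W = "window_state Ns Nt k w w0"
  let ?F = "\<lambda>m. f (?W m) (t m)"
  have th: "theta Nt k \<ge> 1" by (simp add: theta_def)
  have W0: "?W (theta Nt k - 1) = w0" by (simp add: window_state_def)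
  have Wl: "?W (theta Nt k + l - 1) = vec_block Ns w l" if "l \<ge> 1" for l
    using that th by (auto simp: window_state_def)
  have sw: "stack Ns (Nt k) (\<lambda>l. ?W (theta Nt k + l - 1)) = w"
  proof (rule eq_vecI)
    fix p assume "p < dim_vec w"
    then have p: "p < Ns * Nt k" using w by simp
    have "p mod Ns < Ns" using Ns by simp
    then show "stack Ns (Nt k) (\<lambda>l. ?W (theta Nt k + l - 1)) $ p = w $ p"
      using p Wl[of "p div Ns + 1"] by (simp add: stack_def vec_block_def div_mult_mod_eq)
  qed (use w in \<open>simp add: stack_def\<close>)
  have sf: "stack Ns (Nt k) (\<lambda>l. ?F (theta Nt k + l - 1)) =
      stack Ns (Nt k) (\<lambda>l. f (vec_block Ns w l) (t (theta Nt k + l - 1)))"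
  proof -
    have "?F (theta Nt k + (d + 1) - 1) = f (vec_block Ns w (d + 1)) (t (theta Nt k + (d + 1) - 1))" for d
      using Wl[of "d + 1"] by simp
    then show ?thesis unfolding stack_def by metis
  qed
  show ?thesis
  proof (rule eq_vecI, goal_cases)
    case (1 p)
    then have p: "p < Ns * Nt k" by (simp add: lmm_mat0_def)
    have m: "p mod Ns < Ns" using Ns by simp
    have A: "(\<Sum>j\<le>s n. \<alpha> n j * ?W (n - j) $ (p mod Ns)) =
       (lmm_mat Ns Nt s \<alpha> k *\<^sub>v w) $ p + (lmm_mat0 Ns Nt s \<alpha> k *\<^sub>v w0) $ p"
      if "n = theta Nt k + (p div Ns + 1) - 1" for n
      using key[OF p that, of ?W \<alpha>] w0 unfolding W0 sw by simp
    have B: "(\<Sum>j\<le>s n. \<beta> n j * ?F (n - j) $ (p mod Ns)) =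
       (lmm_mat Ns Nt s \<beta> k *\<^sub>v stack Ns (Nt k) (\<lambda>l. f (vec_block Ns w l) (t (theta Nt k + l - 1)))) $ p
       + (lmm_mat0 Ns Nt s \<beta> k *\<^sub>v f w0 (t (theta Nt k - 1))) $ p"
      if "n = theta Nt k + (p div Ns + 1) - 1" for n
      using key[OF p that, of ?F \<beta>] f0 unfolding W0 sf by simp
    have "window_residual Ns f dt t Nt s \<alpha> \<beta> k w w0 $ p =
      (let n = theta Nt k + (p div Ns + 1) - 1 in
        (\<Sum>j\<le>s n. \<alpha> n j * ?W (n - j) $ (p mod Ns))
        - dt * (\<Sum>j\<le>s n. \<beta> n j * ?F (n - j) $ (p mod Ns)))"
      using p m by (simp add: window_residual_def stack_def lmm_residual_def Let_def)
    also have "\<dots> = (lmm_mat Ns Nt s \<alpha> k *\<^sub>v w) $ p + (lmm_mat0 Ns Nt s \<alpha> k *\<^sub>v w0) $ p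
      - dt * ((lmm_mat Ns Nt s \<beta> k *\<^sub>v stack Ns (Nt k) (\<lambda>l. f (vec_block Ns w l) (t (theta Nt k + l - 1)))) $ p
       + (lmm_mat0 Ns Nt s \<beta> k *\<^sub>v f w0 (t (theta Nt k - 1))) $ p)"
      unfolding Let_def by (simp only: A[OF refl] B[OF refl])
    finally show ?case
      using p by (simp add: lmm_mat_def lmm_mat0_def algebra_simps del: index_mult_mat_vec)
  qed (simp add: window_residual_def stack_def lmm_mat0_def)
qed

end

theory Submission
  imports Defs "Jordan_Normal_Form.Spectral_Radius" "HOL-Analysis.Function_Topology"
    "HOL-Analysis.L2_Norm"
begin

text \<open>
  On window \<open>k\<close> the residual is bounded below by \<open>a\<^sup>k\<close> times a perturbation of the window states, and
  it changes by at most \<open>b\<^sup>k\<close> times a perturbation of the starting state. Comparing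
  \<open>r(ut; ut\<^sub>0)\<close> with \<open>r(u; ut\<^sub>0)\<close>, and using \<open>r(u; u\<^sub>0) = 0\<close>, gives
  \<open>a\<^sup>k |e\<^sup>k| \<le> |r(ut; ut\<^sub>0)| + b\<^sup>k |e\<^sub>0\<^sup>k|\<close>. By minimality of \<open>ut\<close> the residual on the right is at most
  \<open>|r(Pu; ut\<^sub>0)| \<le> |r(Pu; Pu\<^sub>0)| + b\<^sup>k |ut\<^sub>0 - Pu\<^sub>0|\<close>, and \<open>|ut\<^sub>0 - Pu\<^sub>0| \<le> |ut\<^sub>0 - u\<^sub>0|\<close> because
  \<open>ut\<^sub>0\<close> lies in the affine space projected onto. Since \<open>|e\<^sub>0\<^sup>k| \<le> |e\<^sup>k\<^sup>-\<^sup>1|\<close> and \<open>e\<^sub>0\<^sup>0 = 0\<close>, the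
  recursion \<open>a\<^sup>k |e\<^sup>k| \<le> |r(Pu; Pu\<^sub>0)| + 2 b\<^sup>k |e\<^sup>k\<^sup>-\<^sup>1|\<close> unrolls to the claim.
\<close>

section \<open>The Euclidean norm\<close>

lemma scalar_prod_self_nonneg: "0 \<le> (v :: rvec) \<bullet> v"
  using conjugate_square_ge_0_vec[of v] by simp

lemma vnorm_eq_L2_set: "v \<in> carrier_vec n \<Longrightarrow> vnorm v = L2_set (\<lambda>i. v $ i) {0..<n}"
  by (simp add: vnorm_def L2_set_def scalar_prod_def power2_eq_square)

lemma vnorm_nonneg: "0 \<le> vnorm v"
  by (simp add: vnorm_def scalar_prod_self_nonneg)

lemma vnorm_power2: "(vnorm v)\<^sup>2 = v \<bullet> v"
  by (simp add: vnorm_def scalar_prod_self_nonneg)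

lemma vnorm_zero: "vnorm (0\<^sub>v n) = 0"
  by (simp add: vnorm_def)

lemma vnorm_smult: "vnorm (c \<cdot>\<^sub>v v) = \<bar>c\<bar> * vnorm v"
  by (simp add: vnorm_def real_sqrt_mult mult.assoc[symmetric])

lemma vnorm_triangle_ineq:
  assumes "v \<in> carrier_vec n" "w \<in> carrier_vec n"
  shows "vnorm (v + w) \<le> vnorm v + vnorm w"
proof -
  have "vnorm (v + w) = L2_set (\<lambda>i. v $ i + w $ i) {0..<n}"
    using assms by (subst vnorm_eq_L2_set[of _ n]) (auto intro!: L2_set_cong)
  then show ?thesis
    using assms by (simp add: vnorm_eq_L2_set[of _ n] L2_set_triangle_ineq)
qed

lemma vnorm_triangle_ineq4:
  assumes "v \<in> carrier_vec n" "w \<in> carrier_vec n"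
  shows "vnorm (v - w) \<le> vnorm v + vnorm w"
proof -
  have "v - w = v + (-1) \<cdot>\<^sub>v w" using assms by (intro eq_vecI) auto
  then show ?thesis using vnorm_triangle_ineq[of v n "(-1) \<cdot>\<^sub>v w"] assms by (simp add: vnorm_smult)
qed

lemma vnorm_triangle_ineq2:
  assumes "v \<in> carrier_vec n" "w \<in> carrier_vec n"
  shows "vnorm v - vnorm w \<le> vnorm (v - w)"
proof -
  have "v = w + (v - w)" using assms by (intro eq_vecI) auto
  then show ?thesis using vnorm_triangle_ineq[of w n "v - w"] assms by simp
qed

lemma scalar_prod_le_vnorm_mult:
  assumes "v \<in> carrier_vec n" "w \<in> carrier_vec n"
  shows "v \<bullet> w \<le> vnorm v * vnorm w"
proof -
  have "v \<bullet> w \<le> (\<Sum>i\<in>{0..<n}. \<bar>v $ i\<bar> * \<bar>w $ i\<bar>)"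
    using assms by (auto simp: scalar_prod_def abs_mult[symmetric] intro!: sum_mono)
  also have "\<dots> \<le> vnorm v * vnorm w"
    using assms by (simp add: vnorm_eq_L2_set[of _ n] L2_set_mult_ineq)
  finally show ?thesis .
qed

section \<open>Quadratic forms\<close>

lemma linear_coeff_eq_0_if_quadratic_nonneg:
  fixes D P :: real
  assumes nonneg: "\<And>c. 0 \<le> 2 * c * D + c\<^sup>2 * P"
  shows "D = 0"
proof -
  define q where "q = \<bar>P\<bar> + 1"
  have q_pos: "0 < q" and P_le: "P \<le> q" by (simp_all add: q_def)
  have "2 * D\<^sup>2 / q \<le> D\<^sup>2 * P / q\<^sup>2"
    using nonneg[of "- D / q"] by (simp add: power_divide power2_eq_square)
  also have "\<dots> \<le> D\<^sup>2 / q"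
    using q_pos mult_left_mono[OF P_le, of "D\<^sup>2"] by (simp add: field_simps power2_eq_square)
  finally show ?thesis using q_pos by (simp add: divide_le_cancel)
qed

lemma quadratic_form_add_smult:
  fixes G :: rmat
  assumes G: "G \<in> carrier_mat n n" and sym: "transpose_mat G = G"
    and v: "v \<in> carrier_vec n" and w: "w \<in> carrier_vec n"
  shows "(v + c \<cdot>\<^sub>v w) \<bullet> (G *\<^sub>v (v + c \<cdot>\<^sub>v w)) =
    v \<bullet> (G *\<^sub>v v) + 2 * c * (w \<bullet> (G *\<^sub>v v)) + c\<^sup>2 * (w \<bullet> (G *\<^sub>v w))"
proof -
  have Gv_carrier: "G *\<^sub>v v \<in> carrier_vec n" and Gw_carrier: "G *\<^sub>v w \<in> carrier_vec n"
    using G v w by auto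
  have "v \<bullet> (G *\<^sub>v w) = w \<bullet> (G *\<^sub>v v)"
    using transpose_vec_mult_scalar[OF G w v] comm_scalar_prod[OF w Gv_carrier] by (simp add: sym)
  moreover have "G *\<^sub>v (v + c \<cdot>\<^sub>v w) = G *\<^sub>v v + c \<cdot>\<^sub>v (G *\<^sub>v w)"
    using G v w by (simp add: mult_add_distrib_mat_vec[of _ n n] mult_mat_vec[of _ n n])
  ultimately show ?thesis
    using v w Gv_carrier Gw_carrier
    by (simp add: add_scalar_prod_distrib[of _ n] scalar_prod_add_distrib[of _ n]
        power2_eq_square algebra_simps)
qed

lemma scalar_prod_self_add_smult:
  assumes "v \<in> carrier_vec n" "w \<in> carrier_vec n"
  shows "(v + c \<cdot>\<^sub>v w) \<bullet> (v + c \<cdot>\<^sub>v w) = v \<bullet> v + 2 * c * (w \<bullet> v) + c\<^sup>2 * ((w :: rvec) \<bullet> w)"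
  using quadratic_form_add_smult[of "1\<^sub>m n" n v w c] assms by simp

lemma psd_mult_mat_vec_eq_0:
  fixes H :: rmat
  assumes H: "H \<in> carrier_mat n n" and sym: "transpose_mat H = H"
    and psd: "\<And>x. x \<in> carrier_vec n \<Longrightarrow> 0 \<le> x \<bullet> (H *\<^sub>v x)"
    and v: "v \<in> carrier_vec n" and vHv: "v \<bullet> (H *\<^sub>v v) = 0"
  shows "H *\<^sub>v v = 0\<^sub>v n"
proof -
  define h where "h = H *\<^sub>v v"
  have h: "h \<in> carrier_vec n" using H v by (simp add: h_def)
  have "h \<bullet> h = 0"
  proof (rule linear_coeff_eq_0_if_quadratic_nonneg)
    fix c
    have "0 \<le> (v + c \<cdot>\<^sub>v h) \<bullet> (H *\<^sub>v (v + c \<cdot>\<^sub>v h))" using v h by (intro psd) simp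
    also have "\<dots> = 2 * c * (h \<bullet> h) + c\<^sup>2 * (h \<bullet> (H *\<^sub>v h))"
      unfolding quadratic_form_add_smult[OF H sym v h] using vHv by (simp flip: h_def)
    finally show "0 \<le> 2 * c * (h \<bullet> h) + c\<^sup>2 * (h \<bullet> (H *\<^sub>v h))" .
  qed
  then show ?thesis using conjugate_square_eq_0_vec[OF h] by (simp add: h_def)
qed

text \<open>
  The dimension \<open>n\<close> is a term, so compactness of the sphere is taken from the product topology on
  \<open>nat \<Rightarrow> real\<close>, with coordinates from \<open>n\<close> on equal to 0.
\<close>

lemma compact_unit_sphere_coordinates:
  "compact {x :: nat \<Rightarrow> real. (\<forall>i\<ge>n. x i = 0) \<and> (\<Sum>i<n. (x i)\<^sup>2) = 1}" (is "compact ?S")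
proof -
  let ?C = "PiE UNIV (\<lambda>_ :: nat. {-1..1 :: real})"
  have "compact ?C"
    using compactin_PiE[of "\<lambda>_. euclidean" UNIV "\<lambda>_ :: nat. {-1..1 :: real}"]
    by (simp add: euclidean_product_topology)
  moreover have "closed ?S"
  proof -
    have "{x :: nat \<Rightarrow> real. \<forall>i\<ge>n. x i = 0} = (\<Inter>i\<in>{n..}. {x. x i = 0})" by auto
    moreover have "closed {x :: nat \<Rightarrow> real. x i = 0}" for i
      by (intro closed_Collect_eq continuous_on_product_coordinates continuous_on_const)
    ultimately have "closed {x :: nat \<Rightarrow> real. \<forall>i\<ge>n. x i = 0}" by auto
    moreover have "closed {x :: nat \<Rightarrow> real. (\<Sum>i<n. (x i)\<^sup>2) = 1}"
      by (intro closed_Collect_eq continuous_intros continuous_on_product_coordinates)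
    ultimately show ?thesis by (rule closed_Collect_conj)
  qed
  moreover have "?S \<subseteq> ?C"
  proof
    fix x assume x: "x \<in> ?S"
    have "x i \<in> {-1..1}" for i
    proof (cases "i < n")
      case True
      then have "(x i)\<^sup>2 \<le> (\<Sum>i<n. (x i)\<^sup>2)" by (intro member_le_sum) auto
      then show ?thesis using x abs_square_le_1[of "x i"] by auto
    qed (use x in simp)
    then show "x \<in> ?C" by auto
  qed
  ultimately show ?thesis using compact_Int_closed[of ?C ?S] by (simp only: Int_absorb1)
qed

lemma continuous_attains_min_on_unit_sphere:
  fixes q :: "rvec \<Rightarrow> real"
  assumes cont: "continuous_on UNIV (\<lambda>x. q (vec n x))" and n_pos: "0 < n"
  obtains v where "v \<in> carrier_vec n" "v \<bullet> v = 1"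
    and "\<And>x. x \<in> carrier_vec n \<Longrightarrow> x \<bullet> x = 1 \<Longrightarrow> q v \<le> q x"
proof -
  define S where "S = {x :: nat \<Rightarrow> real. (\<forall>i\<ge>n. x i = 0) \<and> (\<Sum>i<n. (x i)\<^sup>2) = 1}"
  have sphere: "vec n x \<bullet> vec n x = (\<Sum>i<n. (x i)\<^sup>2)" for x :: "nat \<Rightarrow> real"
    by (simp add: scalar_prod_def power2_eq_square lessThan_atLeast0)
  have compact: "compact S"
    unfolding S_def by (rule compact_unit_sphere_coordinates)
  have "(\<Sum>i<n. (if i = 0 then 1 else 0 :: real)\<^sup>2) = (\<Sum>i<n. if i = 0 then 1 else 0)"
    by (rule sum.cong) auto
  then have "(\<lambda>i. if i = 0 then 1 else 0) \<in> S" using n_pos by (simp add: S_def)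
  then have nonempty: "S \<noteq> {}" by blast
  obtain z where z: "z \<in> S" and minimal: "\<And>y. y \<in> S \<Longrightarrow> q (vec n z) \<le> q (vec n y)"
    using continuous_attains_inf[OF compact nonempty continuous_on_subset[OF cont subset_UNIV]]
    by blast
  show thesis
  proof (rule that[of "vec n z"])
    fix x :: rvec assume x: "x \<in> carrier_vec n" "x \<bullet> x = 1"
    define y where "y = (\<lambda>i. if i < n then x $ i else 0)"
    have x_eq: "x = vec n y" using x by (auto simp: y_def)
    have "(\<Sum>i<n. (y i)\<^sup>2) = 1" using x(2) unfolding x_eq sphere .
    then have "y \<in> S" by (simp add: S_def y_def)
    then show "q (vec n z) \<le> q x" unfolding x_eq by (rule minimal)
  qed (use z in \<open>simp_all add: sphere S_def\<close>)
qed

lemma continuous_on_quadratic_form: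
  fixes G :: rmat
  assumes "G \<in> carrier_mat n n"
  shows "continuous_on UNIV (\<lambda>x. vec n x \<bullet> (G *\<^sub>v vec n x))"
proof -
  have "(\<lambda>x. vec n x \<bullet> (G *\<^sub>v vec n x)) = (\<lambda>x. \<Sum>i<n. x i * (\<Sum>j<n. G $$ (i, j) * x j))"
    using assms by (auto simp: scalar_prod_def lessThan_atLeast0 intro!: sum.cong)
  then show ?thesis
    by (simp only:) (intro continuous_intros continuous_on_product_coordinates)
qed

lemma quadratic_form_rayleigh_min:
  fixes G :: rmat
  assumes G: "G \<in> carrier_mat n n" and n_pos: "0 < n"
  obtains v where "v \<in> carrier_vec n" "v \<bullet> v = 1"
    and "\<And>x. x \<in> carrier_vec n \<Longrightarrow> v \<bullet> (G *\<^sub>v v) * (x \<bullet> x) \<le> x \<bullet> (G *\<^sub>v x)"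
proof -
  obtain v where v: "v \<in> carrier_vec n" "v \<bullet> v = 1"
    and minimal: "\<And>x. x \<in> carrier_vec n \<Longrightarrow> x \<bullet> x = 1 \<Longrightarrow> v \<bullet> (G *\<^sub>v v) \<le> x \<bullet> (G *\<^sub>v x)"
    using continuous_attains_min_on_unit_sphere[OF continuous_on_quadratic_form[OF G] n_pos] by blast
  have "v \<bullet> (G *\<^sub>v v) * (x \<bullet> x) \<le> x \<bullet> (G *\<^sub>v x)" if x: "x \<in> carrier_vec n" for x
  proof (cases "x = 0\<^sub>v n")
    case True
    then show ?thesis using G by simp
  next
    case False
    then have pos: "0 < x \<bullet> x"
      using conjugate_square_greater_0_vec[OF x] by simp
    define c where "c = 1 / vnorm x"
    have c_sq: "c * c = 1 / (x \<bullet> x)"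
      by (simp add: c_def power_divide vnorm_power2 flip: power2_eq_square)
    have "(c \<cdot>\<^sub>v x) \<bullet> (c \<cdot>\<^sub>v x) = 1"
      using pos c_sq by (simp add: mult.assoc[symmetric])
    then have "v \<bullet> (G *\<^sub>v v) \<le> (c \<cdot>\<^sub>v x) \<bullet> (G *\<^sub>v (c \<cdot>\<^sub>v x))"
      using x by (intro minimal) auto
    also have "\<dots> = (x \<bullet> (G *\<^sub>v x)) / (x \<bullet> x)"
      using x G c_sq by (simp add: mult_mat_vec[OF G x] mult.assoc[symmetric])
    finally show ?thesis using pos by (simp add: field_simps)
  qed
  with v show thesis by (rule that)
qed

text \<open>
  If the Rayleigh quotient is minimal at \<open>v\<close> with value \<open>e\<close>, then \<open>G - e I\<close> is positive semidefinite
  and its quadratic form vanishes at \<open>v\<close>.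
\<close>

lemma symmetric_min_eigenvalue:
  fixes G :: rmat
  assumes G: "G \<in> carrier_mat n n" and n_pos: "0 < n" and sym: "transpose_mat G = G"
  obtains e where "eigenvalue G e"
    and "\<And>x. x \<in> carrier_vec n \<Longrightarrow> e * (x \<bullet> x) \<le> x \<bullet> (G *\<^sub>v x)"
proof -
  obtain v where v: "v \<in> carrier_vec n" "v \<bullet> v = 1"
    and bound: "\<And>x. x \<in> carrier_vec n \<Longrightarrow> v \<bullet> (G *\<^sub>v v) * (x \<bullet> x) \<le> x \<bullet> (G *\<^sub>v x)"
    using quadratic_form_rayleigh_min[OF G n_pos] by blast
  define e where "e = v \<bullet> (G *\<^sub>v v)"
  define H where "H = G - e \<cdot>\<^sub>m 1\<^sub>m n"
  have H: "H \<in> carrier_mat n n" by (simp add: H_def minus_carrier_mat)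
  have smult_one: "(e \<cdot>\<^sub>m 1\<^sub>m n) *\<^sub>v x = e \<cdot>\<^sub>v x" if "x \<in> carrier_vec n" for x
    using that by (intro eq_vecI) auto
  have H_mult_vec: "H *\<^sub>v x = G *\<^sub>v x - e \<cdot>\<^sub>v x" if "x \<in> carrier_vec n" for x
    using G that by (simp add: H_def minus_mult_distrib_mat_vec[of _ n n] smult_one)
  have H_quadratic_form: "x \<bullet> (H *\<^sub>v x) = x \<bullet> (G *\<^sub>v x) - e * (x \<bullet> x)" if "x \<in> carrier_vec n" for x
    using G that by (simp add: H_mult_vec scalar_prod_minus_distrib[of _ n])
  have "H *\<^sub>v v = 0\<^sub>v n"
  proof (rule psd_mult_mat_vec_eq_0[OF H])
    have "transpose_mat (e \<cdot>\<^sub>m 1\<^sub>m n) = e \<cdot>\<^sub>m 1\<^sub>m n" by (intro eq_matI) auto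
    then show "transpose_mat H = H" using G by (simp add: H_def transpose_minus[of _ n n] sym)
  qed (use v bound in \<open>simp_all add: H_quadratic_form e_def\<close>)
  moreover have "G *\<^sub>v v = H *\<^sub>v v + e \<cdot>\<^sub>v v"
    unfolding H_mult_vec[OF v(1)] using G v by (intro eq_vecI) auto
  ultimately have "G *\<^sub>v v = e \<cdot>\<^sub>v v" using v by simp
  moreover have "v \<noteq> 0\<^sub>v n" using v by auto
  ultimately have "eigenvalue G e"
    using v G by (auto simp: eigenvalue_def eigenvector_def)
  then show thesis using bound that by (simp add: e_def)
qed

lemma symmetric_max_eigenvalue:
  fixes G :: rmat
  assumes G: "G \<in> carrier_mat n n" and n_pos: "0 < n" and sym: "transpose_mat G = G"
  obtains e where "eigenvalue G e"
    and "\<And>x. x \<in> carrier_vec n \<Longrightarrow> x \<bullet> (G *\<^sub>v x) \<le> e * (x \<bullet> x)"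
proof -
  have "transpose_mat (- G) = - G" by (simp add: transpose_uminus sym)
  then obtain e where eigen: "eigenvalue (- G) e"
    and bound: "\<And>x. x \<in> carrier_vec n \<Longrightarrow> e * (x \<bullet> x) \<le> x \<bullet> (- G *\<^sub>v x)"
    using symmetric_min_eigenvalue[of "- G" n] G n_pos by auto
  from eigen obtain v where v: "v \<in> carrier_vec n" "v \<noteq> 0\<^sub>v n" "- G *\<^sub>v v = e \<cdot>\<^sub>v v"
    using G by (auto simp: eigenvalue_def eigenvector_def)
  have "G *\<^sub>v v = - (- G *\<^sub>v v)" using v(1) G by simp
  also have "\<dots> = (- e) \<cdot>\<^sub>v v" unfolding v(3) by (intro eq_vecI) auto
  finally have "eigenvalue G (- e)"
    using v G by (auto simp: eigenvalue_def eigenvector_def)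
  moreover have "x \<bullet> (G *\<^sub>v x) \<le> - e * (x \<bullet> x)" if x: "x \<in> carrier_vec n" for x
    using bound[OF x] x G by simp
  ultimately show thesis by (rule that)
qed

section \<open>Singular values\<close>

lemma transpose_gram_mat:
  fixes M :: rmat
  assumes "M \<in> carrier_mat m n"
  shows "transpose_mat (transpose_mat M * M) = transpose_mat M * M"
  using assms by (simp add: transpose_mult[of _ n m _ n])

lemma scalar_prod_gram_mat_vec:
  fixes M :: rmat
  assumes M: "M \<in> carrier_mat m n" and x: "x \<in> carrier_vec n"
  shows "x \<bullet> ((transpose_mat M * M) *\<^sub>v x) = (M *\<^sub>v x) \<bullet> (M *\<^sub>v x)"
proof -
  have Mx_carrier: "M *\<^sub>v x \<in> carrier_vec m" and tM_carrier: "transpose_mat M \<in> carrier_mat n m"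
    using M x by auto
  have "x \<bullet> ((transpose_mat M * M) *\<^sub>v x) = (transpose_mat M *\<^sub>v (M *\<^sub>v x)) \<bullet> x"
    using M x tM_carrier Mx_carrier comm_scalar_prod[of x n "transpose_mat M *\<^sub>v (M *\<^sub>v x)"] by simp
  also have "\<dots> = (M *\<^sub>v x) \<bullet> (M *\<^sub>v x)"
    by (rule transpose_vec_mult_scalar[OF M x Mx_carrier])
  finally show ?thesis .
qed

lemma finite_singular_values: "finite (singular_values M)"
proof -
  let ?G = "if dim_col M \<le> dim_row M then transpose_mat M * M else M * transpose_mat M"
  have "?G \<in> carrier_mat (dim_row ?G) (dim_row ?G)" by auto
  then have "finite (spectrum ?G)" by (rule card_finite_spectrum(1))
  moreover have "singular_values M = sqrt ` spectrum ?G"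
    unfolding singular_values_def spectrum_def by blast
  ultimately show ?thesis by simp
qed

lemma sqrt_eigenvalue_gram_mat_bounds:
  assumes M: "M \<in> carrier_mat m n" and "n \<le> m" and eigen: "eigenvalue (transpose_mat M * M) e"
  shows "sigma_min M \<le> sqrt e" "sqrt e \<le> sigma_max M"
proof -
  have "sqrt e \<in> singular_values M" using assms by (auto simp: singular_values_def)
  then show "sigma_min M \<le> sqrt e" "sqrt e \<le> sigma_max M"
    by (simp_all add: sigma_min_def sigma_max_def finite_singular_values)
qed

lemma sigma_max_transpose:
  assumes "M \<in> carrier_mat m n" "m \<noteq> n"
  shows "sigma_max (transpose_mat M) = sigma_max M"
  using assms by (auto simp: sigma_max_def singular_values_def)

lemma sigma_min_mult_vnorm_le:
  assumes M: "M \<in> carrier_mat m n" and dims: "n \<le> m" "0 < n" and x: "x \<in> carrier_vec n"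
  shows "sigma_min M * vnorm x \<le> vnorm (M *\<^sub>v x)"
proof -
  have "transpose_mat M * M \<in> carrier_mat n n" using M by simp
  then obtain e where eigen: "eigenvalue (transpose_mat M * M) e"
    and bound: "e * (x \<bullet> x) \<le> x \<bullet> ((transpose_mat M * M) *\<^sub>v x)"
    using symmetric_min_eigenvalue[OF _ dims(2) transpose_gram_mat[OF M]] x by metis
  have "sigma_min M * vnorm x \<le> sqrt e * vnorm x"
    by (intro mult_right_mono vnorm_nonneg sqrt_eigenvalue_gram_mat_bounds[OF M dims(1) eigen])
  also have "\<dots> = sqrt (e * (x \<bullet> x))" by (simp add: vnorm_def real_sqrt_mult)
  also have "\<dots> \<le> vnorm (M *\<^sub>v x)"
    using bound by (simp add: vnorm_def scalar_prod_gram_mat_vec[OF M x])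
  finally show ?thesis .
qed

lemma vnorm_mult_mat_vec_le_tall:
  assumes M: "M \<in> carrier_mat m n" and dims: "n \<le> m" "0 < n" and x: "x \<in> carrier_vec n"
  shows "vnorm (M *\<^sub>v x) \<le> sigma_max M * vnorm x"
proof -
  have "transpose_mat M * M \<in> carrier_mat n n" using M by simp
  then obtain e where eigen: "eigenvalue (transpose_mat M * M) e"
    and bound: "x \<bullet> ((transpose_mat M * M) *\<^sub>v x) \<le> e * (x \<bullet> x)"
    using symmetric_max_eigenvalue[OF _ dims(2) transpose_gram_mat[OF M]] x by metis
  have "vnorm (M *\<^sub>v x) \<le> sqrt (e * (x \<bullet> x))"
    using bound by (simp add: vnorm_def scalar_prod_gram_mat_vec[OF M x])
  also have "\<dots> = sqrt e * vnorm x" by (simp add: vnorm_def real_sqrt_mult)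
  also have "\<dots> \<le> sigma_max M * vnorm x"
    by (intro mult_right_mono vnorm_nonneg sqrt_eigenvalue_gram_mat_bounds[OF M dims(1) eigen])
  finally show ?thesis .
qed

lemma sigma_max_nonneg:
  assumes M: "M \<in> carrier_mat m n" and dims: "0 < m" "0 < n"
  shows "0 \<le> sigma_max M"
proof -
  obtain N m' n' where N: "N \<in> carrier_mat m' n'" "n' \<le> m'" "0 < n'"
    and eq: "sigma_max N = sigma_max M"
    using that[of M m n] that[of "transpose_mat M" n m] sigma_max_transpose[OF M] M dims
    by (cases "n \<le> m") auto
  have "0 \<le> vnorm (N *\<^sub>v unit_vec n' 0)" by (rule vnorm_nonneg)
  also have "\<dots> \<le> sigma_max N * vnorm (unit_vec n' 0)"
    by (rule vnorm_mult_mat_vec_le_tall[OF N]) simp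
  also have "vnorm (unit_vec n' 0) = 1" using N(3) by (simp add: vnorm_def)
  finally show ?thesis by (simp add: eq)
qed

lemma vnorm_mult_mat_vec_le:
  assumes M: "M \<in> carrier_mat m n" and dims: "0 < m" "0 < n" and x: "x \<in> carrier_vec n"
  shows "vnorm (M *\<^sub>v x) \<le> sigma_max M * vnorm x"
proof (cases "n \<le> m")
  case True
  then show ?thesis by (rule vnorm_mult_mat_vec_le_tall[OF M _ dims(2) x])
next
  case False
  let ?y = "M *\<^sub>v x"
  have y: "?y \<in> carrier_vec m" and tM_carrier: "transpose_mat M \<in> carrier_mat n m" using M x by auto
  have "vnorm ?y * vnorm ?y = (transpose_mat M *\<^sub>v ?y) \<bullet> x"
    using transpose_vec_mult_scalar[OF M x y] by (simp add: vnorm_power2 flip: power2_eq_square)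
  also have "\<dots> \<le> vnorm (transpose_mat M *\<^sub>v ?y) * vnorm x"
    using tM_carrier y x by (intro scalar_prod_le_vnorm_mult) auto
  also have "\<dots> \<le> (sigma_max M * vnorm ?y) * vnorm x"
    using vnorm_mult_mat_vec_le_tall[OF tM_carrier _ dims(1) y] sigma_max_transpose[OF M] False
    by (intro mult_right_mono vnorm_nonneg) auto
  finally have "vnorm ?y * vnorm ?y \<le> vnorm ?y * (sigma_max M * vnorm x)" by (simp add: mult_ac)
  moreover have "0 \<le> sigma_max M * vnorm x"
    by (intro mult_nonneg_nonneg sigma_max_nonneg[OF M dims] vnorm_nonneg)
  ultimately show ?thesis
    using vnorm_nonneg[of ?y] by (auto simp: mult_le_cancel_left)
qed

text \<open>
  The window residual is a sum of maps \<open>x \<mapsto> M x - c N F(x)\<close> with \<open>F\<close> Lipschitz. Below, \<open>X\<close> and \<open>Y\<close>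
  stand for \<open>F(x)\<close> and \<open>F(y)\<close>.
\<close>

context
  fixes M N :: rmat and x y X Y :: rvec and c K :: real and m n n' :: nat
  assumes M: "M \<in> carrier_mat m n" and N: "N \<in> carrier_mat m n'"
    and dims: "0 < m" "0 < n'"
    and x: "x \<in> carrier_vec n" and y: "y \<in> carrier_vec n"
    and X: "X \<in> carrier_vec n'" and Y: "Y \<in> carrier_vec n'"
    and c_nonneg: "0 \<le> c" and lipschitz: "vnorm (X - Y) \<le> K * vnorm (x - y)"
begin

lemma semilinear_diff_eq:
  "(M *\<^sub>v x - c \<cdot>\<^sub>v (N *\<^sub>v X)) - (M *\<^sub>v y - c \<cdot>\<^sub>v (N *\<^sub>v Y)) =
    M *\<^sub>v (x - y) - c \<cdot>\<^sub>v (N *\<^sub>v (X - Y))"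
  unfolding mult_minus_distrib_mat_vec[OF M x y] mult_minus_distrib_mat_vec[OF N X Y]
  using M N by (intro eq_vecI) (auto simp: right_diff_distrib simp del: index_mult_mat_vec)

lemma vnorm_smult_mult_mat_vec_diff_le:
  "vnorm (c \<cdot>\<^sub>v (N *\<^sub>v (X - Y))) \<le> c * K * sigma_max N * vnorm (x - y)"
proof -
  have "vnorm (N *\<^sub>v (X - Y)) \<le> sigma_max N * vnorm (X - Y)"
    using X Y by (intro vnorm_mult_mat_vec_le[OF N dims]) simp
  also have "\<dots> \<le> sigma_max N * (K * vnorm (x - y))"
    by (rule mult_left_mono[OF lipschitz sigma_max_nonneg[OF N dims]])
  finally have "c * vnorm (N *\<^sub>v (X - Y)) \<le> c * (sigma_max N * (K * vnorm (x - y)))"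
    by (rule mult_left_mono[OF _ c_nonneg])
  then show ?thesis using c_nonneg by (simp add: vnorm_smult mult_ac)
qed

lemma vnorm_semilinear_diff_ge:
  assumes "n \<le> m" "0 < n"
  shows "(sigma_min M - sigma_max N * c * K) * vnorm (x - y) \<le>
    vnorm ((M *\<^sub>v x - c \<cdot>\<^sub>v (N *\<^sub>v X)) - (M *\<^sub>v y - c \<cdot>\<^sub>v (N *\<^sub>v Y)))"
proof -
  have "sigma_min M * vnorm (x - y) \<le> vnorm (M *\<^sub>v (x - y))"
    using x y by (intro sigma_min_mult_vnorm_le[OF M assms]) simp
  moreover have "vnorm (M *\<^sub>v (x - y)) - vnorm (c \<cdot>\<^sub>v (N *\<^sub>v (X - Y))) \<le>
      vnorm (M *\<^sub>v (x - y) - c \<cdot>\<^sub>v (N *\<^sub>v (X - Y)))"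
    using M N x y X Y by (intro vnorm_triangle_ineq2[of _ m]) auto
  ultimately show ?thesis
    unfolding semilinear_diff_eq using vnorm_smult_mult_mat_vec_diff_le
    by (simp add: algebra_simps)
qed

lemma vnorm_semilinear_diff_le:
  assumes "0 < n"
  shows "vnorm ((M *\<^sub>v x - c \<cdot>\<^sub>v (N *\<^sub>v X)) - (M *\<^sub>v y - c \<cdot>\<^sub>v (N *\<^sub>v Y))) \<le>
    (sigma_max M + c * K * sigma_max N) * vnorm (x - y)"
proof -
  have "vnorm (M *\<^sub>v (x - y)) \<le> sigma_max M * vnorm (x - y)"
    using x y by (intro vnorm_mult_mat_vec_le[OF M dims(1) assms]) simp
  moreover have "vnorm (M *\<^sub>v (x - y) - c \<cdot>\<^sub>v (N *\<^sub>v (X - Y))) \<le>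
      vnorm (M *\<^sub>v (x - y)) + vnorm (c \<cdot>\<^sub>v (N *\<^sub>v (X - Y)))"
    using M N x y X Y by (intro vnorm_triangle_ineq4[of _ m]) auto
  ultimately show ?thesis
    unfolding semilinear_diff_eq using vnorm_smult_mult_mat_vec_diff_le
    by (simp add: distrib_right)
qed

end

section \<open>Projection onto affine subspaces\<close>

lemma affine_projection_orthogonal:
  assumes T_affine: "affine_subspace d T" and p_min: "is_arg_min (\<lambda>w. vnorm (u - w)) (\<lambda>w. w \<in> T) p"
    and x_mem: "x \<in> T" and u: "u \<in> carrier_vec d"
  shows "(x - p) \<bullet> (u - p) = 0"
proof (rule linear_coeff_eq_0_if_quadratic_nonneg)
  fix c :: real
  have p_mem: "p \<in> T" and minimal: "\<And>w. w \<in> T \<Longrightarrow> vnorm (u - p) \<le> vnorm (u - w)"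
    using p_min by (auto simp: is_arg_min_linorder)
  have p_carrier: "p \<in> carrier_vec d" and x_carrier: "x \<in> carrier_vec d"
    using T_affine p_mem x_mem by (auto simp: affine_subspace_def)
  have "(- c) \<cdot>\<^sub>v x + (1 + c) \<cdot>\<^sub>v p \<in> T"
    using T_affine x_mem p_mem by (simp add: affine_subspace_def)
  from minimal[OF this] have "vnorm (u - p) \<le> vnorm (u - ((- c) \<cdot>\<^sub>v x + (1 + c) \<cdot>\<^sub>v p))" .
  also have "u - ((- c) \<cdot>\<^sub>v x + (1 + c) \<cdot>\<^sub>v p) = (u - p) + c \<cdot>\<^sub>v (x - p)"
    using u p_carrier x_carrier by (intro eq_vecI) (auto simp: algebra_simps)
  finally have "(u - p) \<bullet> (u - p) \<le> ((u - p) + c \<cdot>\<^sub>v (x - p)) \<bullet> ((u - p) + c \<cdot>\<^sub>v (x - p))"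
    by (simp add: vnorm_def)
  also have "\<dots> = (u - p) \<bullet> (u - p) + 2 * c * ((x - p) \<bullet> (u - p)) + c\<^sup>2 * ((x - p) \<bullet> (x - p))"
    using u p_carrier x_carrier by (intro scalar_prod_self_add_smult[of _ d]) auto
  finally show "0 \<le> 2 * c * ((x - p) \<bullet> (u - p)) + c\<^sup>2 * ((x - p) \<bullet> (x - p))" by simp
qed

lemma vnorm_affine_projection_diff_le:
  assumes T_affine: "affine_subspace d T" and p_min: "is_arg_min (\<lambda>w. vnorm (u - w)) (\<lambda>w. w \<in> T) p"
    and x_mem: "x \<in> T" and u: "u \<in> carrier_vec d"
  shows "vnorm (x - p) \<le> vnorm (x - u)"
proof -
  have p_carrier: "p \<in> carrier_vec d" and x_carrier: "x \<in> carrier_vec d"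
    using T_affine p_min x_mem by (auto simp: affine_subspace_def is_arg_min_def)
  have "x - u = (x - p) + (-1) \<cdot>\<^sub>v (u - p)"
    using u p_carrier x_carrier by (intro eq_vecI) auto
  then have "(x - u) \<bullet> (x - u) = (x - p) \<bullet> (x - p) - 2 * ((u - p) \<bullet> (x - p)) + (u - p) \<bullet> (u - p)"
    using scalar_prod_self_add_smult[of "x - p" d "u - p" "-1"] u p_carrier x_carrier by simp
  also have "(u - p) \<bullet> (x - p) = 0"
    using affine_projection_orthogonal[OF assms] comm_scalar_prod[of "x - p" d "u - p"]
      u p_carrier x_carrier by simp
  finally show ?thesis
    using scalar_prod_self_nonneg[of "u - p"] by (simp add: vnorm_def)
qed

section \<open>Stacked vectors\<close>

lemma vec_block_carrier [simp]: "vec_block d w l \<in> carrier_vec d"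
  by (simp add: vec_block_def)

lemma stack_carrier [simp]: "stack d m g \<in> carrier_vec (d * m)"
  by (simp add: stack_def)

lemma block_entry_index_less:
  fixes l :: nat
  assumes "l < m" "i < d"
  shows "l * d + i < d * m"
proof -
  have "l * d + i < Suc l * d" using assms by simp
  also have "\<dots> \<le> m * d" using assms by (intro mult_le_mono1) simp
  finally show ?thesis by (simp add: mult.commute)
qed

lemma vec_block_stack:
  assumes "g (Suc l) \<in> carrier_vec d" "l < m"
  shows "vec_block d (stack d m g) (Suc l) = g (Suc l)"
proof (rule eq_vecI)
  fix i assume "i < dim_vec (g (Suc l))"
  then have i: "i < d" using assms by simp
  show "vec_block d (stack d m g) (Suc l) $ i = g (Suc l) $ i"
    using block_entry_index_less[OF assms(2) i] i by (simp add: vec_block_def stack_def)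
qed (use assms in \<open>simp add: vec_block_def\<close>)

lemma vec_block_minus:
  assumes "v \<in> carrier_vec (d * m)" "w \<in> carrier_vec (d * m)" "l < m"
  shows "vec_block d (v - w) (Suc l) = vec_block d v (Suc l) - vec_block d w (Suc l)"
  using assms block_entry_index_less[OF assms(3)] by (intro eq_vecI) (auto simp: vec_block_def)

lemma vnorm_power2_eq_sum_vec_block:
  assumes "v \<in> carrier_vec (d * m)"
  shows "(vnorm v)\<^sup>2 = (\<Sum>l<m. (vnorm (vec_block d v (Suc l)))\<^sup>2)"
proof -
  have block: "(\<Sum>p=l * d..<l * d + d. v $ p * v $ p) = (vnorm (vec_block d v (Suc l)))\<^sup>2" for l
    using sum.shift_bounds_nat_ivl[of "\<lambda>p. v $ p * v $ p" 0 "l * d" d]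
    by (simp add: vnorm_power2 scalar_prod_def vec_block_def add.commute)
  have "(vnorm v)\<^sup>2 = (\<Sum>p<m * d. v $ p * v $ p)"
    using assms by (simp add: vnorm_power2 scalar_prod_def lessThan_atLeast0 mult.commute)
  also have "\<dots> = (\<Sum>l<m. \<Sum>p=l * d..<l * d + d. v $ p * v $ p)"
    by (rule sum.nat_group[symmetric])
  finally show ?thesis by (simp only: block)
qed

lemma vnorm_vec_block_le:
  assumes "v \<in> carrier_vec (d * m)" "l < m"
  shows "vnorm (vec_block d v (Suc l)) \<le> vnorm v"
proof -
  have "(vnorm (vec_block d v (Suc l)))\<^sup>2 \<le> (vnorm v)\<^sup>2"
    unfolding vnorm_power2_eq_sum_vec_block[OF assms(1)]
    by (rule member_le_sum[where f = "\<lambda>l. (vnorm (vec_block d v (Suc l)))\<^sup>2"])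
      (use assms(2) in auto)
  then show ?thesis by (rule power2_le_imp_le) (rule vnorm_nonneg)
qed

lemma vnorm_le_if_vec_block_le:
  assumes v: "v \<in> carrier_vec (d * m)" and w: "w \<in> carrier_vec (d * m)" and K_nonneg: "0 \<le> K"
    and block: "\<And>l. l < m \<Longrightarrow> vnorm (vec_block d v (Suc l)) \<le> K * vnorm (vec_block d w (Suc l))"
  shows "vnorm v \<le> K * vnorm w"
proof -
  have "(vnorm v)\<^sup>2 \<le> (\<Sum>l<m. (K * vnorm (vec_block d w (Suc l)))\<^sup>2)"
    unfolding vnorm_power2_eq_sum_vec_block[OF v]
    by (intro sum_mono power_mono vnorm_nonneg) (auto intro: block)
  also have "\<dots> = (K * vnorm w)\<^sup>2"
    by (simp add: power_mult_distrib vnorm_power2_eq_sum_vec_block[OF w] sum_distrib_left)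
  finally show ?thesis
    by (rule power2_le_imp_le) (simp add: K_nonneg vnorm_nonneg)
qed

section \<open>Perturbation of the windowed residual\<close>

lemma lmm_mat_carrier: "lmm_mat d Nt s c k \<in> carrier_mat (d * Nt k) (d * Nt k)"
  by (simp add: lmm_mat_def)

lemma lmm_mat0_carrier: "lmm_mat0 d Nt s c k \<in> carrier_mat (d * Nt k) d"
  by (simp add: lmm_mat0_def)

lemma window_residual_carrier: "window_residual d f dt t Nt s \<alpha> \<beta> k w w0 \<in> carrier_vec (d * Nt k)"
  by (simp add: window_residual_def)

lemma start_state_carrier: "v \<in> carrier_vec d \<Longrightarrow> start_state d Nt v u k \<in> carrier_vec d"
  by (simp add: start_state_def)

lemma trial_space_subset_carrier:
  assumes "V \<in> carrier_mat (d * m) n"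
  shows "trial_space d m v0 V \<subseteq> carrier_vec (d * m)"
  using assms by (auto simp: trial_space_def)

lemma window_time_index_le:
  assumes "k < Nw" "l \<le> Nt k"
  shows "theta Nt k + l - 1 \<le> (\<Sum>k<Nw. Nt k)"
proof -
  have "theta Nt k + l - 1 \<le> (\<Sum>j<Suc k. Nt j)" using assms by (simp add: theta_def)
  also have "\<dots> \<le> (\<Sum>j<Nw. Nt j)" using assms by (intro sum_mono2) auto
  finally show ?thesis .
qed

lemma vnorm_start_state_diff_0:
  "v \<in> carrier_vec d \<Longrightarrow> vnorm (start_state d Nt v u 0 - start_state d Nt v w 0) = 0"
  by (simp add: start_state_def vnorm_zero)

lemma vnorm_start_state_diff_le:
  assumes "u k \<in> carrier_vec (d * Nt k)" "w k \<in> carrier_vec (d * Nt k)" "0 < Nt k"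
  shows "vnorm (start_state d Nt v u (Suc k) - start_state d Nt v' w (Suc k)) \<le> vnorm (u k - w k)"
proof -
  obtain l where Nt_eq: "Nt k = Suc l" using assms(3) by (cases "Nt k") auto
  have "start_state d Nt v u (Suc k) - start_state d Nt v' w (Suc k) = vec_block d (u k - w k) (Suc l)"
    using vec_block_minus[OF assms(1,2), of l] Nt_eq by (simp add: start_state_def)
  then show ?thesis
    using vnorm_vec_block_le[of "u k - w k" d "Nt k" l] assms Nt_eq by simp
qed

locale lipschitz_lmm_windows =
  fixes Ns Nw :: nat and Nt s :: "nat \<Rightarrow> nat" and f :: "rvec \<Rightarrow> real \<Rightarrow> rvec"
    and dt \<kappa> :: real and t :: "nat \<Rightarrow> real" and \<alpha> \<beta> :: "nat \<Rightarrow> nat \<Rightarrow> real"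
  assumes Ns_pos: "0 < Ns" and Nt_pos: "\<And>k. k < Nw \<Longrightarrow> 0 < Nt k"
    and dt_nonneg: "0 \<le> dt" and \<kappa>_nonneg: "0 \<le> \<kappa>"
    and stencil_le: "\<And>k l. k < Nw \<Longrightarrow> 1 \<le> l \<Longrightarrow> l \<le> Nt k \<Longrightarrow> s (theta Nt k + l - 1) \<le> l"
    and f_carrier: "\<And>w n. w \<in> carrier_vec Ns \<Longrightarrow> n \<le> (\<Sum>k<Nw. Nt k) \<Longrightarrow> f w (t n) \<in> carrier_vec Ns"
    and f_lipschitz: "\<And>w y n. w \<in> carrier_vec Ns \<Longrightarrow> y \<in> carrier_vec Ns \<Longrightarrow> n \<le> (\<Sum>k<Nw. Nt k) \<Longrightarrow>
      vnorm (f w (t n) - f y (t n)) \<le> \<kappa> * vnorm (w - y)"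
begin

abbreviation residual :: "nat \<Rightarrow> rvec \<Rightarrow> rvec \<Rightarrow> rvec" where
  "residual \<equiv> window_residual Ns f dt t Nt s \<alpha> \<beta>"

abbreviation A :: "nat \<Rightarrow> rmat" where "A \<equiv> lmm_mat Ns Nt s \<alpha>"
abbreviation B :: "nat \<Rightarrow> rmat" where "B \<equiv> lmm_mat Ns Nt s \<beta>"
abbreviation A0 :: "nat \<Rightarrow> rmat" where "A0 \<equiv> lmm_mat0 Ns Nt s \<alpha>"
abbreviation B0 :: "nat \<Rightarrow> rmat" where "B0 \<equiv> lmm_mat0 Ns Nt s \<beta>"

definition coercivity_const :: "nat \<Rightarrow> real" where
  "coercivity_const k = sigma_min (A k) - sigma_max (B k) * dt * \<kappa>"

definition start_lipschitz_const :: "nat \<Rightarrow> real" where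
  "start_lipschitz_const k = sigma_max (A0 k) + dt * \<kappa> * sigma_max (B0 k)"

definition stacked_rhs :: "nat \<Rightarrow> rvec \<Rightarrow> rvec" where
  "stacked_rhs k w = stack Ns (Nt k) (\<lambda>l. f (vec_block Ns w l) (t (theta Nt k + l - 1)))"

definition state_part :: "nat \<Rightarrow> rvec \<Rightarrow> rvec" where
  "state_part k w = A k *\<^sub>v w - dt \<cdot>\<^sub>v (B k *\<^sub>v stacked_rhs k w)"

definition start_part :: "nat \<Rightarrow> rvec \<Rightarrow> rvec" where
  "start_part k w0 = A0 k *\<^sub>v w0 - dt \<cdot>\<^sub>v (B0 k *\<^sub>v f w0 (t (theta Nt k - 1)))"

lemma state_part_carrier: "state_part k w \<in> carrier_vec (Ns * Nt k)"
  by (intro carrier_vecI) (simp add: state_part_def carrier_matD[OF lmm_mat_carrier])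

lemma start_part_carrier: "start_part k w0 \<in> carrier_vec (Ns * Nt k)"
  by (intro carrier_vecI) (simp add: start_part_def carrier_matD[OF lmm_mat0_carrier])

lemma start_time_index_le: "k < Nw \<Longrightarrow> theta Nt k - 1 \<le> (\<Sum>k<Nw. Nt k)"
  using window_time_index_le[of k Nw 0 Nt] by simp

lemma window_dims: "k < Nw \<Longrightarrow> 0 < Ns * Nt k"
  using Ns_pos Nt_pos by simp

lemma residual_eq_state_part_plus_start_part:
  assumes "k < Nw" "w \<in> carrier_vec (Ns * Nt k)" "w0 \<in> carrier_vec Ns"
  shows "residual k w w0 = state_part k w + start_part k w0"
proof -
  have "residual k w w0 = state_part k w + A0 k *\<^sub>v w0 - dt \<cdot>\<^sub>v (B0 k *\<^sub>v f w0 (t (theta Nt k - 1)))"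
    unfolding state_part_def stacked_rhs_def
    using assms Ns_pos stencil_le f_carrier[OF _ start_time_index_le]
    by (intro window_residual_matrix_form) auto
  then show ?thesis
    using state_part_carrier[of k w]
    by (intro eq_vecI) (auto simp: start_part_def lmm_mat0_def simp del: index_mult_mat_vec)
qed

lemma stacked_rhs_lipschitz:
  assumes k: "k < Nw" and w: "w \<in> carrier_vec (Ns * Nt k)" and y: "y \<in> carrier_vec (Ns * Nt k)"
  shows "vnorm (stacked_rhs k w - stacked_rhs k y) \<le> \<kappa> * vnorm (w - y)"
proof (rule vnorm_le_if_vec_block_le)
  fix l assume l: "l < Nt k"
  then have time_index: "theta Nt k + Suc l - 1 \<le> (\<Sum>k<Nw. Nt k)"
    by (intro window_time_index_le k) simp
  have block: "vec_block Ns (stacked_rhs k v) (Suc l) =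
      f (vec_block Ns v (Suc l)) (t (theta Nt k + Suc l - 1))" for v
    unfolding stacked_rhs_def by (intro vec_block_stack f_carrier time_index l vec_block_carrier)
  have "vec_block Ns (stacked_rhs k w - stacked_rhs k y) (Suc l) =
      vec_block Ns (stacked_rhs k w) (Suc l) - vec_block Ns (stacked_rhs k y) (Suc l)"
    by (rule vec_block_minus[OF _ _ l]) (simp_all add: stacked_rhs_def)
  then show "vnorm (vec_block Ns (stacked_rhs k w - stacked_rhs k y) (Suc l)) \<le>
      \<kappa> * vnorm (vec_block Ns (w - y) (Suc l))"
    unfolding block vec_block_minus[OF w y l]
    by (simp only:) (intro f_lipschitz time_index vec_block_carrier)
qed (use w y \<kappa>_nonneg in \<open>simp_all add: stacked_rhs_def\<close>)

lemma vnorm_residual_diff_state_ge: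
  assumes k: "k < Nw" and w: "w \<in> carrier_vec (Ns * Nt k)" and y: "y \<in> carrier_vec (Ns * Nt k)"
    and w0: "w0 \<in> carrier_vec Ns"
  shows "coercivity_const k * vnorm (w - y) \<le> vnorm (residual k w w0 - residual k y w0)"
proof -
  have "residual k w w0 - residual k y w0 = state_part k w - state_part k y"
    unfolding residual_eq_state_part_plus_start_part[OF k w w0]
      residual_eq_state_part_plus_start_part[OF k y w0]
    using state_part_carrier[of k w] state_part_carrier[of k y] start_part_carrier[of k w0]
    by (intro eq_vecI) auto
  also have "coercivity_const k * vnorm (w - y) \<le> vnorm \<dots>"
    unfolding coercivity_const_def state_part_def
    by (rule vnorm_semilinear_diff_ge[OF lmm_mat_carrier lmm_mat_carrier])
      (use w y dt_nonneg stacked_rhs_lipschitz[OF k w y] window_dims[OF k]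
        in \<open>auto simp: stacked_rhs_def\<close>)
  finally show ?thesis .
qed

lemma vnorm_residual_diff_start_le:
  assumes k: "k < Nw" and w: "w \<in> carrier_vec (Ns * Nt k)"
    and w0: "w0 \<in> carrier_vec Ns" and y0: "y0 \<in> carrier_vec Ns"
  shows "vnorm (residual k w w0 - residual k w y0) \<le> start_lipschitz_const k * vnorm (w0 - y0)"
proof -
  have "residual k w w0 - residual k w y0 = start_part k w0 - start_part k y0"
    unfolding residual_eq_state_part_plus_start_part[OF k w w0]
      residual_eq_state_part_plus_start_part[OF k w y0]
    using state_part_carrier[of k w] start_part_carrier[of k w0] start_part_carrier[of k y0]
    by (intro eq_vecI) auto
  also have "vnorm \<dots> \<le> start_lipschitz_const k * vnorm (w0 - y0)"
    unfolding start_lipschitz_const_def start_part_def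
    by (rule vnorm_semilinear_diff_le[OF lmm_mat0_carrier lmm_mat0_carrier])
      (use w0 y0 dt_nonneg Ns_pos window_dims[OF k] f_carrier f_lipschitz start_time_index_le[OF k]
        in auto)
  finally show ?thesis .
qed

lemma start_lipschitz_const_nonneg: "k < Nw \<Longrightarrow> 0 \<le> start_lipschitz_const k"
  unfolding start_lipschitz_const_def using dt_nonneg \<kappa>_nonneg window_dims Ns_pos
  by (intro add_nonneg_nonneg mult_nonneg_nonneg sigma_max_nonneg[OF lmm_mat0_carrier])

lemma window_error_le:
  assumes k: "k < Nw" and y: "y \<in> carrier_vec (Ns * Nt k)" and y0: "y0 \<in> carrier_vec Ns"
    and exact: "residual k y y0 = 0\<^sub>v (Ns * Nt k)"
    and S_carrier: "S \<subseteq> carrier_vec (Ns * Nt k)" and z_mem: "z \<in> S"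
    and w_min: "is_arg_min (\<lambda>w. (vnorm (residual k w w0))\<^sup>2) (\<lambda>w. w \<in> S) w"
    and T_affine: "affine_subspace Ns T" and w0_mem: "w0 \<in> T"
    and z0_min: "is_arg_min (\<lambda>x. vnorm (y0 - x)) (\<lambda>x. x \<in> T) z0"
  shows "coercivity_const k * vnorm (w - y) \<le>
    vnorm (residual k z z0) + 2 * start_lipschitz_const k * vnorm (w0 - y0)"
proof -
  let ?b = "start_lipschitz_const k" and ?\<delta> = "vnorm (w0 - y0)"
  have w_carrier: "w \<in> carrier_vec (Ns * Nt k)" and z_carrier: "z \<in> carrier_vec (Ns * Nt k)"
    and w0_carrier: "w0 \<in> carrier_vec Ns" and z0_carrier: "z0 \<in> carrier_vec Ns"
    using w_min z_mem S_carrier w0_mem z0_min T_affine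
    by (auto simp: is_arg_min_def affine_subspace_def)
  have minimal: "vnorm (residual k w w0) \<le> vnorm (residual k z w0)"
    using w_min z_mem by (auto simp: is_arg_min_linorder vnorm_nonneg intro: power2_le_imp_le)
  have projected: "vnorm (residual k z w0) \<le> vnorm (residual k z z0) + ?b * ?\<delta>"
  proof -
    have "vnorm (residual k z w0) - vnorm (residual k z z0) \<le> vnorm (residual k z w0 - residual k z z0)"
      by (rule vnorm_triangle_ineq2[OF window_residual_carrier window_residual_carrier])
    also have "\<dots> \<le> ?b * vnorm (w0 - z0)"
      by (rule vnorm_residual_diff_start_le[OF k z_carrier w0_carrier z0_carrier])
    also have "\<dots> \<le> ?b * ?\<delta>"
      by (intro mult_left_mono vnorm_affine_projection_diff_le[OF T_affine z0_min w0_mem y0]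
          start_lipschitz_const_nonneg k)
    finally show ?thesis by simp
  qed
  have perturbed: "vnorm (residual k y w0) \<le> ?b * ?\<delta>"
    using vnorm_residual_diff_start_le[OF k y w0_carrier y0]
    by (simp add: exact minus_zero_vec[OF window_residual_carrier])
  have "coercivity_const k * vnorm (w - y) \<le> vnorm (residual k w w0 - residual k y w0)"
    by (rule vnorm_residual_diff_state_ge[OF k w_carrier y w0_carrier])
  also have "\<dots> \<le> vnorm (residual k w w0) + vnorm (residual k y w0)"
    by (rule vnorm_triangle_ineq4[OF window_residual_carrier window_residual_carrier])
  also have "\<dots> \<le> vnorm (residual k z z0) + 2 * ?b * ?\<delta>"
    using minimal projected perturbed by simp
  finally show ?thesis .
qed

end

section \<open>Error accumulation over the windows\<close>

lemma linear_recursion_bound: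
  fixes err start_err R a b :: "nat \<Rightarrow> real"
  assumes a_pos: "\<And>i. i \<le> k \<Longrightarrow> 0 < a i" and b_nonneg: "\<And>i. i \<le> k \<Longrightarrow> 0 \<le> b i"
    and err_le: "\<And>i. i \<le> k \<Longrightarrow> a i * err i \<le> R i + b i * start_err i"
    and start_err_0: "start_err 0 = 0"
    and start_err_Suc: "\<And>i. i < k \<Longrightarrow> start_err (Suc i) \<le> err i"
  shows "err k \<le> (\<Sum>i\<le>k. ((\<Prod>j<k - i. b (k - j)) / (\<Prod>j\<le>k - i. a (k - j))) * R i)"
  using a_pos b_nonneg err_le start_err_Suc
proof (induction k)
  case 0
  then show ?case using start_err_0 by (simp add: field_simps)
next
  case (Suc k)
  let ?C = "\<lambda>k i. (\<Prod>j<k - i. b (k - j)) / (\<Prod>j\<le>k - i. a (k - j))"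
  let ?q = "b (Suc k) / a (Suc k)"
  have a_Suc: "0 < a (Suc k)" and b_Suc: "0 \<le> b (Suc k)" using Suc.prems by simp_all
  have C_Suc: "?C (Suc k) i = ?q * ?C k i" if "i \<le> k" for i
    by (simp only: Suc_diff_le[OF that] prod.lessThan_Suc_shift prod.atMost_Suc_shift
        diff_Suc_Suc diff_zero times_divide_times_eq)
  have "start_err (Suc k) \<le> err k" using Suc.prems by simp
  also have "\<dots> \<le> (\<Sum>i\<le>k. ?C k i * R i)" using Suc.prems by (intro Suc.IH) auto
  finally have "?q * start_err (Suc k) \<le> ?q * (\<Sum>i\<le>k. ?C k i * R i)"
    using a_Suc b_Suc by (intro mult_left_mono) auto
  also have "\<dots> = (\<Sum>i\<le>k. ?C (Suc k) i * R i)"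
    unfolding sum_distrib_left by (rule sum.cong) (simp_all only: C_Suc atMost_iff mult.assoc)
  finally have history: "?q * start_err (Suc k) \<le> (\<Sum>i\<le>k. ?C (Suc k) i * R i)" .
  have "err (Suc k) \<le> R (Suc k) / a (Suc k) + ?q * start_err (Suc k)"
    using Suc.prems(3)[of "Suc k"] a_Suc by (simp add: field_simps)
  also have "\<dots> \<le> (\<Sum>i\<le>Suc k. ?C (Suc k) i * R i)" using history by simp
  finally show ?case .
qed

theorem corollary6p3p1:
  fixes Ns Nw :: nat and Nt s :: "nat \<Rightarrow> nat"
    and f :: "rvec \<Rightarrow> real \<Rightarrow> rvec" and T dt \<kappa> :: real and t :: "nat \<Rightarrow> real"
    and \<alpha> \<beta> :: "nat \<Rightarrow> nat \<Rightarrow> real"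
    and uinit :: rvec and u ut u0 ut0 Pu Pu0 :: "nat \<Rightarrow> rvec"
    and nb :: "nat \<Rightarrow> nat" and V :: "nat \<Rightarrow> rmat" and S \<T> :: "nat \<Rightarrow> rvec set"
    and r :: "nat \<Rightarrow> rvec \<Rightarrow> rvec \<Rightarrow> rvec" and A B A0 B0 :: "nat \<Rightarrow> rmat"
    and a b :: "nat \<Rightarrow> real" and k :: nat
  assumes Ns: "Ns \<ge> 1"
    and f: "\<And>w \<tau>. w \<in> carrier_vec Ns \<Longrightarrow> \<tau> \<in> {0..T} \<Longrightarrow> f w \<tau> \<in> carrier_vec Ns"
    and uinit: "uinit \<in> carrier_vec Ns"
    and Nt: "\<And>k. k < Nw \<Longrightarrow> Nt k \<ge> 1"
    and dt: "dt > 0"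
    and t_step: "\<And>n. n < (\<Sum>k<Nw. Nt k) \<Longrightarrow> t (Suc n) = t n + dt"
    and t_range: "\<And>n. n \<le> (\<Sum>k<Nw. Nt k) \<Longrightarrow> t n \<in> {0..T}"
    and \<alpha>_0: "\<And>n. 1 \<le> n \<Longrightarrow> n \<le> (\<Sum>k<Nw. Nt k) \<Longrightarrow> \<alpha> n 0 \<noteq> 0"
    and \<alpha>_sum: "\<And>n. 1 \<le> n \<Longrightarrow> n \<le> (\<Sum>k<Nw. Nt k) \<Longrightarrow> (\<Sum>j\<le>s n. \<alpha> n j) = 0"
    and s_first: "\<And>k. k < Nw \<Longrightarrow> s (theta Nt k) = 1"
    and s_window: "\<And>k l. k < Nw \<Longrightarrow> 1 \<le> l \<Longrightarrow> l \<le> Nt k \<Longrightarrow> s (theta Nt k + l - 1) \<le> l"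
    and r_def: "r = window_residual Ns f dt t Nt s \<alpha> \<beta>"
    and A_def: "A = lmm_mat Ns Nt s \<alpha>" and B_def: "B = lmm_mat Ns Nt s \<beta>"
    and A0_def: "A0 = lmm_mat0 Ns Nt s \<alpha>" and B0_def: "B0 = lmm_mat0 Ns Nt s \<beta>"
    \<comment> \<open>full-order solution\<close>
    and u0_def: "u0 = start_state Ns Nt uinit u"
    and u: "\<And>k. k < Nw \<Longrightarrow> u k \<in> carrier_vec (Ns * Nt k)"
    and u_res: "\<And>k. k < Nw \<Longrightarrow> r k (u k) (u0 k) = 0\<^sub>v (Ns * Nt k)"
    \<comment> \<open>WST-LSPG solution\<close>
    and ut0_def: "ut0 = start_state Ns Nt uinit ut"
    and V: "\<And>k. k < Nw \<Longrightarrow> V k \<in> carrier_mat (Ns * Nt k) (nb k)"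
    and S_def: "\<And>k. k < Nw \<Longrightarrow> S k = trial_space Ns (Nt k) (ut0 k) (V k)"
    and ut: "\<And>k. k < Nw \<Longrightarrow> is_arg_min (\<lambda>w. (vnorm (r k w (ut0 k)))\<^sup>2) (\<lambda>w. w \<in> S k) (ut k)"
    \<comment> \<open>trial subspaces for the starting states\<close>
    and \<T>: "\<And>k. k < Nw \<Longrightarrow> affine_subspace Ns (\<T> k)"
    and ut0_\<T>: "\<And>k. k < Nw \<Longrightarrow> ut0 k \<in> \<T> k"
    and A1: "\<kappa> > 0"
      "\<And>w y \<tau>. w \<in> carrier_vec Ns \<Longrightarrow> y \<in> carrier_vec Ns \<Longrightarrow> \<tau> \<in> {0..T} \<Longrightarrow>
         vnorm (f w \<tau> - f y \<tau>) \<le> \<kappa> * vnorm (w - y)"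
    and A2: "\<And>k. k < Nw \<Longrightarrow> sigma_min (A k) - sigma_max (B k) * dt * \<kappa> > 0"
    and a_def: "\<And>k. k < Nw \<Longrightarrow> a k = sigma_min (A k) - sigma_max (B k) * dt * \<kappa>"
    and b_def: "\<And>k. k < Nw \<Longrightarrow> b k = sigma_max (A0 k) + dt * \<kappa> * sigma_max (B0 k)"
    and Pu: "\<And>i. i < Nw \<Longrightarrow> is_arg_min (\<lambda>w. vnorm (u i - w)) (\<lambda>w. w \<in> S i) (Pu i)"
    and Pu0: "\<And>i. i < Nw \<Longrightarrow> is_arg_min (\<lambda>w. vnorm (u0 i - w)) (\<lambda>w. w \<in> \<T> i) (Pu0 i)"
    and k: "k < Nw"
  shows "vnorm (ut k - u k) \<le>
    (\<Sum>i\<le>k. ((\<Prod>j<k - i. 2 * b (k - j)) / (\<Prod>j\<le>k - i. a (k - j))) * vnorm (r i (Pu i) (Pu0 i)))"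
proof -
  interpret lipschitz_lmm_windows Ns Nw Nt s f dt \<kappa> t \<alpha> \<beta>
    by unfold_locales (use Ns Nt dt A1 s_window f t_range in \<open>auto simp: Suc_le_eq\<close>)
  have S_carrier: "S i \<subseteq> carrier_vec (Ns * Nt i)" if "i < Nw" for i
    using trial_space_subset_carrier[OF V[OF that]] S_def[OF that] by simp
  have ut_carrier: "ut i \<in> carrier_vec (Ns * Nt i)" if "i < Nw" for i
    using ut[OF that] S_carrier[OF that] by (auto simp: is_arg_min_def)
  have a_eq: "a i = coercivity_const i" and b_eq: "b i = start_lipschitz_const i" if "i < Nw" for i
    by (simp_all add: that a_def b_def coercivity_const_def start_lipschitz_const_def
        A_def B_def A0_def B0_def)
  show ?thesis
  proof (rule linear_recursion_bound[where start_err = "\<lambda>i. vnorm (ut0 i - u0 i)"])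
    show "0 < a i" if "i \<le> k" for i using that k A2 a_def by simp
    show "0 \<le> 2 * b i" if "i \<le> k" for i using that k b_eq start_lipschitz_const_nonneg by simp
    show "a i * vnorm (ut i - u i) \<le>
        vnorm (r i (Pu i) (Pu0 i)) + 2 * b i * vnorm (ut0 i - u0 i)" if "i \<le> k" for i
    proof -
      have i: "i < Nw" using that k by simp
      show ?thesis
        unfolding a_eq[OF i] b_eq[OF i] r_def
        by (rule window_error_le[OF i u[OF i] _ _ S_carrier[OF i] _ _ \<T>[OF i]
              ut0_\<T>[OF i] Pu0[OF i]])
          (use Pu[OF i] ut[OF i] u_res[OF i] uinit
            in \<open>auto simp: is_arg_min_def r_def u0_def start_state_carrier\<close>)
    qed
    show "vnorm (ut0 0 - u0 0) = 0"
      unfolding ut0_def u0_def by (rule vnorm_start_state_diff_0[OF uinit])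
    show "vnorm (ut0 (Suc i) - u0 (Suc i)) \<le> vnorm (ut i - u i)" if "i < k" for i
      unfolding ut0_def u0_def using that k ut_carrier u Nt_pos
      by (intro vnorm_start_state_diff_le) auto
  qed
qed

end
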